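(* Let $\Bbbk$ be an algebraically closed field of characteristic $p>0$. Suppose $G$ is a finite group and $P$ a Sylow $p$-subgroup of $G$. If $U$ is a (finite-dimensional) projective $G$-module over $\Bbbk$, then $\epsilon(G,u)=|P|$ for any $u\in U^G\setminus\{0\}$. In particular, $\epsilon(G,U)=|P|$ if $U^G\neq\{0\}$.
   Context: For a finite-dimensional $G$-module $U$, $\Bbbk[U]\cong S(U^* )$ is the ring of polynomial functions on $U$, with $G$-action $(g\cdot f)(u)=f(g^{-1}u)$; $\Bbbk[U]^G_d$ is the set of homogeneous invariants of degree $d$ together with $0$. The nullcone $\mathcal{N}_{G,U}$ is the common zero set in $U$ of all invariants with constant term zero. For $u\in U$, $\epsilon(G,u)=\inf\{d\in\mathbb{N}_{>0} : \text{there exists } f\in\Bbbk[U]^G_d\text{ with } f(u)\neq 0\}$, where the infimum of the empty set is $\infty$, and $\epsilon(G,U)=\inf\{\epsilon(G,u): u\in U^G\setminus\mathcal{N}_{G,U}\}$. *)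

theory Defs
  imports
    "HOL-Algebra.Group_Action"
    "HOL-Computational_Algebra.Primes"
    "HOL-Computational_Algebra.Polynomial"
    "HOL-Library.Extended_Nat"
    "HOL-Library.Function_Algebras"
begin

definition sylow_subgroup :: "nat \<Rightarrow> ('g, 'x) monoid_scheme \<Rightarrow> 'g set \<Rightarrow> bool" where
  "sylow_subgroup p G P \<longleftrightarrow> subgroup P G \<and> card P = p ^ multiplicity p (card (carrier G))"

locale G_module = group_action G UNIV \<rho> + vector_space scale
  for G :: "('g, 'x) monoid_scheme" (structure)
    and scale :: "'k::field \<Rightarrow> 'u::ab_group_add \<Rightarrow> 'u"
    and \<rho> :: "'g \<Rightarrow> 'u \<Rightarrow> 'u" +
  assumes linear_action: "g \<in> carrier G \<Longrightarrow> Vector_Spaces.linear scale scale (\<rho> g)"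

locale finite_dim_G_module = G_module +
  assumes finite_dimensional: "\<exists>B. finite B \<and> span B = UNIV"

definition G_module_hom ::
  "('g, 'x) monoid_scheme \<Rightarrow> ('k::field \<Rightarrow> 'u::ab_group_add \<Rightarrow> 'u) \<Rightarrow> ('g \<Rightarrow> 'u \<Rightarrow> 'u) \<Rightarrow>
     ('k \<Rightarrow> 'v::ab_group_add \<Rightarrow> 'v) \<Rightarrow> ('g \<Rightarrow> 'v \<Rightarrow> 'v) \<Rightarrow> ('u \<Rightarrow> 'v) \<Rightarrow> bool" where
  "G_module_hom G s \<rho> t \<sigma> \<phi> \<longleftrightarrow>
     Vector_Spaces.linear s t \<phi> \<and> (\<forall>g\<in>carrier G. \<forall>u. \<phi> (\<rho> g u) = \<sigma> g (\<phi> u))"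

definition fixed_points :: "('g, 'x) monoid_scheme \<Rightarrow> ('g \<Rightarrow> 'u \<Rightarrow> 'u) \<Rightarrow> 'u set" where
  "fixed_points G \<rho> = {u. \<forall>g\<in>carrier G. \<rho> g u = u}"

definition fun_scale :: "'k::field \<Rightarrow> ('a \<Rightarrow> 'k) \<Rightarrow> 'a \<Rightarrow> 'k" where
  "fun_scale c f = (\<lambda>x. c * f x)"

text \<open>
  The free module of rank \<open>n\<close> over the group algebra: the family \<open>(\<Sum>h. f (i, h) h)\<close>, \<open>i < n\<close>, of
  elements of the group algebra is encoded by its coefficient function \<open>f\<close>, so that left
  multiplication by \<open>g\<close> sends \<open>f\<close> to \<open>(i, h) \<mapsto> f (i, g\<inverse> h)\<close>.
\<close>

definition free_carrier :: "('g, 'x) monoid_scheme \<Rightarrow> nat \<Rightarrow> (nat \<times> 'g \<Rightarrow> 'k::field) set" where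
  "free_carrier G n = {f. \<forall>i h. f (i, h) \<noteq> 0 \<longrightarrow> i < n \<and> h \<in> carrier G}"

definition free_action ::
  "('g, 'x) monoid_scheme \<Rightarrow> 'g \<Rightarrow> (nat \<times> 'g \<Rightarrow> 'k::field) \<Rightarrow> nat \<times> 'g \<Rightarrow> 'k" where
  "free_action G g f =
     (\<lambda>(i, h). if h \<in> carrier G then f (i, inv\<^bsub>G\<^esub> g \<otimes>\<^bsub>G\<^esub> h) else 0)"

definition free_submodule ::
  "('g, 'x) monoid_scheme \<Rightarrow> nat \<Rightarrow> (nat \<times> 'g \<Rightarrow> 'k::field) set \<Rightarrow> bool" where
  "free_submodule G n A \<longleftrightarrow>
     A \<subseteq> free_carrier G n \<and> module.subspace fun_scale A \<and>
     (\<forall>g\<in>carrier G. \<forall>a\<in>A. free_action G g a \<in> A)"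

text \<open>
  A finitely generated module is projective if it is isomorphic to a direct summand of a free
  module of finite rank. The lemmas \<open>projective_module_lifting\<close> and
  \<open>projective_moduleI_lifting\<close> below relate this to the lifting property, which cannot be used as
  a definition because it quantifies over modules on arbitrary types.
\<close>

definition projective_module ::
  "('g, 'x) monoid_scheme \<Rightarrow> ('k::field \<Rightarrow> 'u::ab_group_add \<Rightarrow> 'u) \<Rightarrow> ('g \<Rightarrow> 'u \<Rightarrow> 'u) \<Rightarrow> bool" where
  "projective_module G scale \<rho> \<longleftrightarrow>
     (\<exists>n A B \<phi>.
        free_submodule G n A \<and> free_submodule G n B \<and>
        A \<inter> B = {0} \<and> free_carrier G n = {a + b | a b. a \<in> A \<and> b \<in> B} \<and>
        G_module_hom G scale \<rho> fun_scale (free_action G) \<phi> \<and> bij_betw \<phi> UNIV A)"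

inductive poly_fun :: "('k::field \<Rightarrow> 'u::ab_group_add \<Rightarrow> 'u) \<Rightarrow> ('u \<Rightarrow> 'k) \<Rightarrow> bool"
  for scale where
  const: "poly_fun scale (\<lambda>u. c)"
| linear: "Vector_Spaces.linear scale (*) l \<Longrightarrow> poly_fun scale l"
| add: "poly_fun scale f \<Longrightarrow> poly_fun scale g \<Longrightarrow> poly_fun scale (\<lambda>u. f u + g u)"
| mult: "poly_fun scale f \<Longrightarrow> poly_fun scale g \<Longrightarrow> poly_fun scale (\<lambda>u. f u * g u)"

inductive homogeneous_poly_fun ::
  "('k::field \<Rightarrow> 'u::ab_group_add \<Rightarrow> 'u) \<Rightarrow> nat \<Rightarrow> ('u \<Rightarrow> 'k) \<Rightarrow> bool"
  for scale where
  const: "homogeneous_poly_fun scale 0 (\<lambda>u. c)"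
| linear: "Vector_Spaces.linear scale (*) l \<Longrightarrow> homogeneous_poly_fun scale 1 l"
| add: "homogeneous_poly_fun scale d f \<Longrightarrow> homogeneous_poly_fun scale d g \<Longrightarrow>
    homogeneous_poly_fun scale d (\<lambda>u. f u + g u)"
| mult: "homogeneous_poly_fun scale d f \<Longrightarrow> homogeneous_poly_fun scale e g \<Longrightarrow>
    homogeneous_poly_fun scale (d + e) (\<lambda>u. f u * g u)"

definition poly_fun_action ::
  "('g, 'x) monoid_scheme \<Rightarrow> ('g \<Rightarrow> 'u \<Rightarrow> 'u) \<Rightarrow> 'g \<Rightarrow> ('u \<Rightarrow> 'k) \<Rightarrow> 'u \<Rightarrow> 'k" where
  "poly_fun_action G \<rho> g f = (\<lambda>u. f (\<rho> (inv\<^bsub>G\<^esub> g) u))"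

definition invariant_ring ::
  "('g, 'x) monoid_scheme \<Rightarrow> ('k::field \<Rightarrow> 'u::ab_group_add \<Rightarrow> 'u) \<Rightarrow> ('g \<Rightarrow> 'u \<Rightarrow> 'u) \<Rightarrow> ('u \<Rightarrow> 'k) set" where
  "invariant_ring G scale \<rho> = {f. poly_fun scale f \<and> (\<forall>g\<in>carrier G. poly_fun_action G \<rho> g f = f)}"

definition homogeneous_invariants ::
  "('g, 'x) monoid_scheme \<Rightarrow> ('k::field \<Rightarrow> 'u::ab_group_add \<Rightarrow> 'u) \<Rightarrow> ('g \<Rightarrow> 'u \<Rightarrow> 'u) \<Rightarrow> nat \<Rightarrow>
     ('u \<Rightarrow> 'k) set" where
  "homogeneous_invariants G scale \<rho> d = {f \<in> invariant_ring G scale \<rho>. homogeneous_poly_fun scale d f}"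

text \<open>The constant term of a polynomial function is its value at \<open>0\<close>.\<close>

definition nullcone ::
  "('g, 'x) monoid_scheme \<Rightarrow> ('k::field \<Rightarrow> 'u::ab_group_add \<Rightarrow> 'u) \<Rightarrow> ('g \<Rightarrow> 'u \<Rightarrow> 'u) \<Rightarrow> 'u set" where
  "nullcone G scale \<rho> = {u. \<forall>f\<in>invariant_ring G scale \<rho>. f 0 = 0 \<longrightarrow> f u = 0}"

definition epsilon_at ::
  "('g, 'x) monoid_scheme \<Rightarrow> ('k::field \<Rightarrow> 'u::ab_group_add \<Rightarrow> 'u) \<Rightarrow> ('g \<Rightarrow> 'u \<Rightarrow> 'u) \<Rightarrow> 'u \<Rightarrow> enat" where
  "epsilon_at G scale \<rho> u =
     Inf {enat d | d. d > 0 \<and> (\<exists>f\<in>homogeneous_invariants G scale \<rho> d. f u \<noteq> 0)}"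

definition epsilon ::
  "('g, 'x) monoid_scheme \<Rightarrow> ('k::field \<Rightarrow> 'u::ab_group_add \<Rightarrow> 'u) \<Rightarrow> ('g \<Rightarrow> 'u \<Rightarrow> 'u) \<Rightarrow> enat" where
  "epsilon G scale \<rho> = (INF u \<in> fixed_points G \<rho> - nullcone G scale \<rho>. epsilon_at G scale \<rho> u)"

lemma vector_space_fun_scale: "vector_space (fun_scale :: 'k::field \<Rightarrow> ('a \<Rightarrow> 'k) \<Rightarrow> 'a \<Rightarrow> 'k)"
  by unfold_locales (auto simp: fun_scale_def fun_eq_iff algebra_simps)

lemma linearI_vs:
  assumes "vector_space s" "vector_space t"
    and "\<And>x y. f (x + y) = f x + f y" "\<And>c x. f (s c x) = t c (f x)"
  shows "Vector_Spaces.linear s t f"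
  using assms by (simp add: Vector_Spaces.linear_def module_hom_def module_hom_axioms_def
      vector_space_def module_def)

lemma linear_addD: "Vector_Spaces.linear s t f \<Longrightarrow> f (x + y) = f x + f y"
  and linear_scaleD: "Vector_Spaces.linear s t f \<Longrightarrow> f (s c x) = t c (f x)"
  by (simp_all add: Vector_Spaces.linear_def module_hom_def module_hom_axioms_def)

lemma linear_zeroD: "Vector_Spaces.linear s t f \<Longrightarrow> f 0 = 0"
  by (metis add_cancel_right_right linear_addD)

lemma linear_sumD: "Vector_Spaces.linear s t f \<Longrightarrow> f (\<Sum>i\<in>I. x i) = (\<Sum>i\<in>I. f (x i))"
  by (induction I rule: infinite_finite_induct) (simp_all add: linear_zeroD linear_addD)

lemma subspace_fun_scale:
  fixes A :: "('a \<Rightarrow> 'k::field) set"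
  shows "module.subspace fun_scale A \<longleftrightarrow>
     0 \<in> A \<and> (\<forall>x\<in>A. \<forall>y\<in>A. x + y \<in> A) \<and> (\<forall>c. \<forall>x\<in>A. fun_scale c x \<in> A)"
proof -
  interpret vector_space "fun_scale :: 'k::field \<Rightarrow> ('a \<Rightarrow> 'k) \<Rightarrow> 'a \<Rightarrow> 'k"
    by (rule vector_space_fun_scale)
  show ?thesis by (simp add: subspace_def)
qed

context G_module
begin

lemma group_G: "group G"
  using group_hom group_hom.axioms(1) by blast

lemma action_mult:
  assumes "g \<in> carrier G" "h \<in> carrier G" shows "\<rho> (g \<otimes> h) u = \<rho> g (\<rho> h u)"
  using composition_rule[of u g h] assms by simp

lemma action_one: "\<rho> \<one> u = u"
  using id_eq_one by (metis UNIV_I restrict_apply)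

definition free_eval :: "nat \<Rightarrow> (nat \<Rightarrow> 'u) \<Rightarrow> (nat \<times> 'g \<Rightarrow> 'k) \<Rightarrow> 'u" where
  "free_eval n m f = (\<Sum>i<n. \<Sum>h\<in>carrier G. scale (f (i, h)) (\<rho> h (m i)))"

lemma linear_free_eval: "Vector_Spaces.linear fun_scale scale (free_eval n m)"
  by (rule linearI_vs)
    (auto simp: vector_space_fun_scale vector_space_axioms free_eval_def fun_scale_def
      scale_left_distrib sum.distrib scale_sum_right)

lemma free_eval_translate:
  assumes g: "g \<in> carrier G"
    and f': "\<And>i h. i < n \<Longrightarrow> h \<in> carrier G \<Longrightarrow> f' (i, h) = f (i, inv g \<otimes> h)"
  shows "free_eval n m f' = \<rho> g (free_eval n m f)"
proof -
  interpret group G by (rule group_G)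
  note lin = linear_action[OF g]
  have "(\<Sum>h\<in>carrier G. scale (f' (i, h)) (\<rho> h (m i))) =
      (\<Sum>h\<in>carrier G. \<rho> g (scale (f (i, h)) (\<rho> h (m i))))" if "i < n" for i
    using g that
    by (intro sum.reindex_bij_witness[of _ "\<lambda>h. g \<otimes> h" "\<lambda>h. inv g \<otimes> h"])
      (auto simp: m_assoc[symmetric] f' linear_scaleD[OF lin] action_mult[symmetric])
  then show ?thesis
    by (simp add: free_eval_def linear_sumD[OF lin])
qed

lemma free_eval_hom:
  "g \<in> carrier G \<Longrightarrow> free_eval n m (free_action G g f) = \<rho> g (free_eval n m f)"
  by (rule free_eval_translate) (auto simp: free_action_def)

end

lemma projective_module_lifting:
  fixes G :: "('g, 'x) monoid_scheme" and sU :: "'k::field \<Rightarrow> 'u::ab_group_add \<Rightarrow> 'u"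
    and sM :: "'k \<Rightarrow> 'm::ab_group_add \<Rightarrow> 'm" and sN :: "'k \<Rightarrow> 'n::ab_group_add \<Rightarrow> 'n"
  assumes fin: "finite (carrier G)" and U: "G_module G sU \<rho>" and proj: "projective_module G sU \<rho>"
    and M: "G_module G sM \<mu>" and N: "G_module G sN \<nu>"
    and p: "G_module_hom G sM \<mu> sN \<nu> p" "surj p"
    and a: "G_module_hom G sU \<rho> sN \<nu> a"
  shows "\<exists>b. G_module_hom G sU \<rho> sM \<mu> b \<and> p \<circ> b = a"
proof -
  interpret U: G_module G sU \<rho> by (rule U)
  interpret M: G_module G sM \<mu> by (rule M)
  interpret N: G_module G sN \<nu> by (rule N)
  interpret group G by (rule U.group_G)
  from proj obtain n A B \<phi> where A: "free_submodule G n A" and B: "free_submodule G n B"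
    and AB: "A \<inter> B = {0}" "free_carrier G n = {a + b | a b. a \<in> A \<and> b \<in> B}"
    and \<phi>: "G_module_hom G sU \<rho> fun_scale (free_action G) \<phi>" "bij_betw \<phi> UNIV A"
    unfolding projective_module_def by blast
  have lin\<phi>: "Vector_Spaces.linear sU fun_scale \<phi>"
    and eq\<phi>: "\<And>g u. g \<in> carrier G \<Longrightarrow> \<phi> (\<rho> g u) = free_action G g (\<phi> u)"
    using \<phi> by (auto simp: G_module_hom_def)
  have linp: "Vector_Spaces.linear sM sN p"
    and eqp: "\<And>g u. g \<in> carrier G \<Longrightarrow> p (\<mu> g u) = \<nu> g (p u)"
    using p by (auto simp: G_module_hom_def)
  have lina: "Vector_Spaces.linear sU sN a"
    and eqa: "\<And>g u. g \<in> carrier G \<Longrightarrow> a (\<rho> g u) = \<nu> g (a u)"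
    using a by (auto simp: G_module_hom_def)
  note sA = A[unfolded free_submodule_def subspace_fun_scale]
  note sB = B[unfolded free_submodule_def subspace_fun_scale]
  define r where "r f = (THE u. \<exists>b\<in>B. f = \<phi> u + b)" for f
  have r: "r (\<phi> u + b) = u" if "b \<in> B" for u b
    unfolding r_def
  proof (rule the_equality)
    show "\<exists>b'\<in>B. \<phi> u + b = \<phi> u + b'" using that by blast
    fix v assume "\<exists>b'\<in>B. \<phi> u + b = \<phi> v + b'"
    then obtain b' where b': "b' \<in> B" "\<phi> u + b = \<phi> v + b'" by blast
    have "\<phi> u + fun_scale (-1) (\<phi> v) = b' + fun_scale (-1) b"
    proof
      fix x
      have "\<phi> u x + b x = \<phi> v x + b' x" using fun_cong[OF b'(2), of x] by simp
      then show "(\<phi> u + fun_scale (-1) (\<phi> v)) x = (b' + fun_scale (-1) b) x"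
        by (simp add: fun_scale_def algebra_simps)
    qed
    moreover have "\<phi> u + fun_scale (-1) (\<phi> v) \<in> A"
      using sA bij_betw_apply[OF \<phi>(2)] by blast
    moreover have "b' + fun_scale (-1) b \<in> B" using sB b' that by auto
    ultimately have "\<phi> u + fun_scale (-1) (\<phi> v) = 0" using AB(1) by auto
    then have "\<phi> u = \<phi> v" by (auto simp: fun_scale_def fun_eq_iff)
    then show "v = u" using \<phi>(2) by (auto simp: bij_betw_def inj_def)
  qed
  have decomp: "\<exists>u. \<exists>b\<in>B. f = \<phi> u + b" if "f \<in> free_carrier G n" for f
    using that \<phi>(2) unfolding AB(2) bij_betw_def by auto
  have \<phi>F: "\<phi> u \<in> free_carrier G n" for u
    using sA \<phi>(2) by (auto simp: bij_betw_def)
  have r_add: "r (f + f') = r f + r f'" if F: "f \<in> free_carrier G n" "f' \<in> free_carrier G n" for f f'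
  proof -
    obtain u b u' b' where *: "b \<in> B" "f = \<phi> u + b" "b' \<in> B" "f' = \<phi> u' + b'"
      using decomp[OF F(1)] decomp[OF F(2)] by blast
    have eq: "f + f' = \<phi> (u + u') + (b + b')"
      unfolding *(2,4) linear_addD[OF lin\<phi>] by (simp add: ac_simps)
    have "b + b' \<in> B" using * sB by blast
    then show ?thesis unfolding eq unfolding *(2,4) by (simp only: r *(1,3))
  qed
  have r_scale: "r (fun_scale c f) = sU c (r f)" if F: "f \<in> free_carrier G n" for f c
  proof -
    obtain u b where *: "b \<in> B" "f = \<phi> u + b"
      using decomp[OF F] by blast
    have eq: "fun_scale c f = \<phi> (sU c u) + fun_scale c b"
      by (auto simp: * linear_scaleD[OF lin\<phi>] fun_scale_def fun_eq_iff algebra_simps)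
    have "fun_scale c b \<in> B" using * sB by blast
    then show ?thesis unfolding eq unfolding *(2) by (simp only: r *(1))
  qed
  have r_act: "r (free_action G g f) = \<rho> g (r f)" if F: "f \<in> free_carrier G n" "g \<in> carrier G" for f g
  proof -
    obtain u b where *: "b \<in> B" "f = \<phi> u + b"
      using decomp[OF F(1)] by blast
    have eq: "free_action G g f = \<phi> (\<rho> g u) + free_action G g b"
      using that by (auto simp: * eq\<phi> free_action_def fun_eq_iff)
    have "free_action G g b \<in> B" using * sB that by blast
    then show ?thesis unfolding eq unfolding *(2) by (simp only: r *(1))
  qed
  have addF: "f + f' \<in> free_carrier G n"
    if "f \<in> free_carrier G n" "f' \<in> free_carrier G n" for f f' :: "nat \<times> 'g \<Rightarrow> 'k"
    using that by (simp add: free_carrier_def) (metis add_0)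
  have r_0: "r 0 = 0"
    using r[of 0 0] sB linear_zeroD[OF lin\<phi>] by simp
  have r_sum: "r (\<Sum>x\<in>X. f x) = (\<Sum>x\<in>X. r (f x)) \<and> (\<Sum>x\<in>X. f x) \<in> free_carrier G n"
    if "finite X" "\<And>x. x \<in> X \<Longrightarrow> f x \<in> free_carrier G n" for X :: "(nat \<times> 'g) set" and f
    using that
  proof (induction X rule: finite_induct)
    case empty
    show ?case using r_0 by (auto simp: free_carrier_def zero_fun_def)
  next
    case (insert x X)
    have IH: "r (\<Sum>x\<in>X. f x) = (\<Sum>x\<in>X. r (f x))" "(\<Sum>x\<in>X. f x) \<in> free_carrier G n"
      using insert by auto
    have x: "f x \<in> free_carrier G n" using insert.prems by blast
    show ?case
      unfolding sum.insert[OF insert.hyps] r_add[OF x IH(2)] IH(1)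
      using addF[OF x IH(2)] by blast
  qed
  define e where "e i = (\<lambda>(j, h). if j = i \<and> h = \<one>\<^bsub>G\<^esub> then 1 else 0 :: 'k)" for i :: nat
  have eF: "e i \<in> free_carrier G n" if "i < n" for i
    using that by (auto simp: e_def free_carrier_def split: if_splits)
  have eA: "free_action G h (e i) = (\<lambda>x. if x = (i, h) then 1 else 0)" if "h \<in> carrier G" for i h
  proof -
    have "(inv\<^bsub>G\<^esub> h \<otimes>\<^bsub>G\<^esub> k = \<one>\<^bsub>G\<^esub>) = (k = h)" if "k \<in> carrier G" for k
      using that \<open>h \<in> carrier G\<close> by (metis inv_closed inv_equality inv_inv l_inv)
    then show ?thesis using that by (auto simp: free_action_def e_def fun_eq_iff)
  qed
  have r_eval: "r f = U.free_eval n (\<lambda>i. r (e i)) f" if f: "f \<in> free_carrier G n" for f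
  proof -
    let ?X = "{..<n} \<times> carrier G"
    let ?t = "\<lambda>(i, h). fun_scale (f (i, h)) (free_action G h (e i))"
    have tF: "?t x \<in> free_carrier G n" if "x \<in> ?X" for x
      using that by (auto simp: eA fun_scale_def free_carrier_def split: if_splits)
    have aF: "free_action G h (e i) \<in> free_carrier G n" if "i < n" "h \<in> carrier G" for i h
      using that by (auto simp: eA free_carrier_def split: if_splits)
    have *: "(\<Sum>x\<in>X. ?t x) y = (\<Sum>x\<in>X. ?t x y)" for X y
      by (induction X rule: infinite_finite_induct) auto
    have "f = (\<Sum>x\<in>?X. ?t x)"
    proof
      fix y
      have "(\<Sum>x\<in>?X. ?t x y) = (\<Sum>x\<in>?X. if x = y then f y else 0)"
        by (rule sum.cong) (auto simp: eA fun_scale_def)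
      also have "\<dots> = f y"
        using fin f by (cases y) (auto simp: free_carrier_def)
      finally show "f y = (\<Sum>x\<in>?X. ?t x) y" using * by simp
    qed
    then have "r f = (\<Sum>x\<in>?X. r (?t x))"
      using r_sum[of ?X ?t] tF fin by simp
    also have "\<dots> = (\<Sum>(i, h)\<in>?X. sU (f (i, h)) (\<rho> h (r (e i))))"
      by (rule sum.cong) (auto simp: r_scale r_act aF eF)
    finally show ?thesis
      by (simp add: U.free_eval_def sum.cartesian_product)
  qed
  define m where "m i = (SOME x. p x = a (r (e i)))" for i
  have m: "p (m i) = a (r (e i))" for i
    unfolding m_def using p(2) by (metis (mono_tags) someI_ex surjD)
  define b where "b u = M.free_eval n m (\<phi> u)" for u
  have pb: "p (b u) = a (U.free_eval n (\<lambda>i. r (e i)) (\<phi> u))" for u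
    unfolding b_def M.free_eval_def U.free_eval_def
    by (simp add: linear_sumD[OF linp] linear_scaleD[OF linp] linear_sumD[OF lina]
        linear_scaleD[OF lina] eqp eqa m)
  have "U.free_eval n (\<lambda>i. r (e i)) (\<phi> u) = u" for u
    using r_eval[OF \<phi>F, of u] r[of 0 u] sB by simp
  then have "p \<circ> b = a" using pb by (simp add: fun_eq_iff)
  moreover have "G_module_hom G sU \<rho> sM \<mu> b"
    unfolding G_module_hom_def
  proof safe
    show "Vector_Spaces.linear sU sM b"
      by (rule linearI_vs)
        (auto simp: U.vector_space_axioms M.vector_space_axioms b_def linear_addD[OF lin\<phi>]
          linear_scaleD[OF lin\<phi>] linear_addD[OF M.linear_free_eval]
          linear_scaleD[OF M.linear_free_eval])
    show "b (\<rho> g u) = \<mu> g (b u)" if "g \<in> carrier G" for g u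
      using that by (simp add: b_def eq\<phi> M.free_eval_hom)
  qed
  ultimately show ?thesis by blast
qed

lemma projective_moduleI_lifting:
  fixes sU :: "'k::field \<Rightarrow> 'u::ab_group_add \<Rightarrow> 'u" and G :: "('g, 'x) monoid_scheme"
  assumes fin: "finite (carrier G)" and U: "finite_dim_G_module G sU \<rho>"
    and split: "\<And>\<mu> (p :: (nat \<times> 'g \<Rightarrow> 'k) \<Rightarrow> 'u). G_module G fun_scale \<mu> \<Longrightarrow>
      G_module_hom G fun_scale \<mu> sU \<rho> p \<Longrightarrow> surj p \<Longrightarrow>
      \<exists>s. G_module_hom G sU \<rho> fun_scale \<mu> s \<and> p \<circ> s = id"
  shows "projective_module G sU \<rho>"
proof -
  interpret U: finite_dim_G_module G sU \<rho> by (rule U)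
  interpret group G by (rule U.group_G)
  define \<mu> where "\<mu> g f = (\<lambda>(i, h). if h \<in> carrier G then f (i, inv\<^bsub>G\<^esub> g \<otimes>\<^bsub>G\<^esub> h) else f (i, h))"
    for g and f :: "nat \<times> 'g \<Rightarrow> 'k"
  have \<mu>_mult: "\<mu> (g \<otimes>\<^bsub>G\<^esub> h) f = \<mu> g (\<mu> h f)" if "g \<in> carrier G" "h \<in> carrier G" for g h f
    using that by (auto simp: \<mu>_def fun_eq_iff inv_mult_group m_assoc)
  have \<mu>_one: "\<mu> \<one>\<^bsub>G\<^esub> f = f" for f
    by (auto simp: \<mu>_def fun_eq_iff)
  have \<mu>_bij: "bij (\<mu> g)" if "g \<in> carrier G" for g
    using that \<mu>_mult[of g "inv\<^bsub>G\<^esub> g"] \<mu>_mult[of "inv\<^bsub>G\<^esub> g" g]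
    by (intro o_bij[of "\<mu> (inv\<^bsub>G\<^esub> g)"]) (auto simp: fun_eq_iff \<mu>_one)
  have \<mu>_lin: "Vector_Spaces.linear fun_scale fun_scale (\<mu> g)" for g
    by (rule linearI_vs) (auto simp: vector_space_fun_scale \<mu>_def fun_scale_def fun_eq_iff)
  have M: "G_module G fun_scale \<mu>"
    unfolding G_module_def G_module_axioms_def group_action_def group_hom_def group_hom_axioms_def
    using group_BijGroup[of "UNIV :: (nat \<times> 'g \<Rightarrow> 'k) set"] \<mu>_mult \<mu>_bij \<mu>_lin
    by (auto simp: vector_space_fun_scale is_group hom_def BijGroup_def Bij_def
        compose_def fun_eq_iff)
  obtain S where S: "finite S" "U.span S = UNIV" using U.finite_dimensional by blast
  obtain n m where nm: "S = m ` {..<n :: nat}" "inj_on m {..<n}"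
    using finite_imp_nat_seg_image_inj_on[OF S(1)] by (auto simp: lessThan_def)
  define p where "p = U.free_eval n m"
  have linp: "Vector_Spaces.linear fun_scale sU p"
    unfolding p_def by (rule U.linear_free_eval)
  have p\<mu>: "p (\<mu> g f) = \<rho> g (p f)" if "g \<in> carrier G" for g f
    unfolding p_def by (rule U.free_eval_translate) (auto simp: that \<mu>_def)
  have "surj p"
  proof (rule surjI)
    fix u
    have "u \<in> range (\<lambda>c. \<Sum>v\<in>S. sU (c v) v)"
      unfolding U.span_finite[OF S(1), symmetric] S(2) by simp
    then obtain c where c: "u = (\<Sum>v\<in>S. sU (c v) v)" by blast
    define f where "f = (\<lambda>(i, h). if h = \<one>\<^bsub>G\<^esub> then c (m i) else 0)"
    have "p f = (\<Sum>i<n. \<Sum>h\<in>carrier G. if h = \<one>\<^bsub>G\<^esub> then sU (c (m i)) (m i) else 0)"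
      unfolding p_def U.free_eval_def
      by (intro sum.cong) (auto simp: f_def U.action_one)
    also have "\<dots> = u"
      using fin nm by (simp add: c sum.reindex)
    finally show "p (SOME f. p f = u) = u" by (rule someI[where P = "\<lambda>f. p f = u"])
  qed
  then obtain s where s: "G_module_hom G sU \<rho> fun_scale \<mu> s" "p \<circ> s = id"
    using split[OF M, of p] linp p\<mu> by (auto simp: G_module_hom_def)
  have lins: "Vector_Spaces.linear sU fun_scale s"
    and eqs: "\<And>g u. g \<in> carrier G \<Longrightarrow> s (\<rho> g u) = \<mu> g (s u)"
    using s by (auto simp: G_module_hom_def)
  define t where "t f = (\<lambda>(i, h). if i < n \<and> h \<in> carrier G then f (i, h) else 0)"
    for f :: "nat \<times> 'g \<Rightarrow> 'k"
  have pt: "p (t f) = p f" for f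
    unfolding p_def U.free_eval_def by (auto simp: t_def intro!: sum.cong)
  have tF: "t f \<in> free_carrier G n" for f
    by (auto simp: t_def free_carrier_def split: if_splits)
  have t\<mu>: "t (\<mu> g f) = free_action G g (t f)" if "g \<in> carrier G" for g f
    using that by (auto simp: t_def \<mu>_def free_action_def fun_eq_iff)
  define \<phi> where "\<phi> u = t (s u)" for u
  have p\<phi>: "p (\<phi> u) = u" for u
    using s(2) by (simp add: \<phi>_def pt fun_eq_iff)
  have lin\<phi>: "Vector_Spaces.linear sU fun_scale \<phi>"
    by (rule linearI_vs)
      (auto simp: U.vector_space_axioms vector_space_fun_scale \<phi>_def linear_addD[OF lins]
        linear_scaleD[OF lins] t_def fun_scale_def fun_eq_iff)
  have eq\<phi>: "\<phi> (\<rho> g u) = free_action G g (\<phi> u)" if "g \<in> carrier G" for g u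
    using that by (simp add: \<phi>_def eqs t\<mu>)
  define B where "B = {f \<in> free_carrier G n. p f = 0}"
  have aF: "free_action G g f \<in> free_carrier G n"
    if "g \<in> carrier G" "f \<in> free_carrier G n" for g and f :: "nat \<times> 'g \<Rightarrow> 'k"
    using that by (auto simp: free_action_def free_carrier_def)
  have pa: "p (free_action G g f) = \<rho> g (p f)" if "g \<in> carrier G" for g f
    unfolding p_def using that by (rule U.free_eval_hom)
  have 1: "free_submodule G n (range \<phi>)"
    unfolding free_submodule_def subspace_fun_scale
  proof (intro conjI ballI allI)
    show "range \<phi> \<subseteq> free_carrier G n" using tF by (auto simp: \<phi>_def)
    show "0 \<in> range \<phi>" using linear_zeroD[OF lin\<phi>] by (rule range_eqI[OF sym])
    show "x + y \<in> range \<phi>" if "x \<in> range \<phi>" "y \<in> range \<phi>" for x y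
      using that by (auto simp: linear_addD[OF lin\<phi>, symmetric])
    show "fun_scale c x \<in> range \<phi>" if "x \<in> range \<phi>" for c x
      using that by (auto simp: linear_scaleD[OF lin\<phi>, symmetric])
    show "free_action G g x \<in> range \<phi>" if "g \<in> carrier G" "x \<in> range \<phi>" for g x
      using that by (auto simp: eq\<phi>[symmetric])
  qed
  have 2: "free_submodule G n B"
    unfolding free_submodule_def subspace_fun_scale B_def
  proof (intro conjI ballI allI)
    show "0 \<in> {f \<in> free_carrier G n. p f = 0}"
      using linear_zeroD[OF linp] by (simp add: free_carrier_def)
    show "x + y \<in> {f \<in> free_carrier G n. p f = 0}"
      if "x \<in> {f \<in> free_carrier G n. p f = 0}" "y \<in> {f \<in> free_carrier G n. p f = 0}" for x y
      using that by (simp add: linear_addD[OF linp] free_carrier_def) (metis add_0)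
    show "fun_scale c x \<in> {f \<in> free_carrier G n. p f = 0}"
      if "x \<in> {f \<in> free_carrier G n. p f = 0}" for c x
      using that by (simp add: linear_scaleD[OF linp] free_carrier_def) (auto simp: fun_scale_def)
    show "free_action G g x \<in> {f \<in> free_carrier G n. p f = 0}"
      if "g \<in> carrier G" "x \<in> {f \<in> free_carrier G n. p f = 0}" for g x
      using that by (simp add: aF pa linear_zeroD[OF U.linear_action])
  qed blast
  have 3: "range \<phi> \<inter> B = {0}"
    using 1 2 p\<phi> linear_zeroD[OF lin\<phi>]
    by (auto simp: B_def free_submodule_def subspace_fun_scale)
  have 4: "f \<in> {a + b | a b. a \<in> range \<phi> \<and> b \<in> B}" if f: "f \<in> free_carrier G n" for f
  proof -
    define b where "b = f + fun_scale (-1) (\<phi> (p f))"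
    have "b \<in> free_carrier G n"
      using f tF[of "s (p f)"] by (auto simp: b_def free_carrier_def fun_scale_def \<phi>_def) metis+
    moreover have "p b = 0"
      by (simp add: b_def linear_addD[OF linp] linear_scaleD[OF linp] p\<phi>)
    moreover have "f = \<phi> (p f) + b" by (auto simp: b_def fun_scale_def fun_eq_iff)
    ultimately show ?thesis unfolding B_def by blast
  qed
  have 5: "a + b \<in> free_carrier G n" if "a \<in> range \<phi>" "b \<in> B" for a b
  proof -
    have "a \<in> free_carrier G n" "b \<in> free_carrier G n"
      using that 1 unfolding free_submodule_def B_def by blast+
    then show ?thesis by (simp add: free_carrier_def) (metis add_0)
  qed
  have 6: "bij_betw \<phi> UNIV (range \<phi>)"
    using p\<phi> by (auto simp: bij_betw_def intro: inj_on_inverseI)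
  show ?thesis
    unfolding projective_module_def G_module_hom_def
  proof (intro exI conjI ballI allI)
    show "free_carrier G n = {a + b | a b. a \<in> range \<phi> \<and> b \<in> B}"
      using 4 5 by blast
  qed (fact 1 2 3 lin\<phi> 6 | erule eq\<phi>)+
qed

end

theory Submission
  imports Defs "HOL-Algebra.Left_Coset"
begin

text \<open>
  Upper bound: for a linear form \<open>l\<close> with \<open>l u \<noteq> 0\<close>, the relative transfer from \<open>P\<close> to \<open>G\<close> of the
  norm of \<open>l\<close> over \<open>P\<close> is an invariant of degree \<open>|P|\<close> whose value at the fixed point \<open>u\<close> is
  \<open>[G : P] (l u)^|P|\<close>, and \<open>p\<close> does not divide the index.

  Lower bound: since \<open>U\<close> is a summand of a free module, a fixed point is a trace
  \<open>u = (\<Sum>h. h w)\<close>, so an invariant \<open>f\<close> of degree \<open>d\<close> pulls back along \<open>x \<mapsto> (\<Sum>h. x h (h w))\<close> to a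
  polynomial in the coordinates of the regular representation whose value at \<open>(1, \<dots>, 1)\<close>, the sum
  of its coefficients, is \<open>f u\<close>. The \<open>p\<close>-group \<open>P\<close> permutes the monomials and preserves the
  coefficients, so in characteristic \<open>p\<close> only the monomials fixed by \<open>P\<close> contribute to this sum;
  their exponents are constant on the cosets \<open>P h\<close>, which forces \<open>d \<ge> |P|\<close> if \<open>d > 0\<close>.
\<close>

interpretation fun_vs: vector_space "fun_scale :: 'k::field \<Rightarrow> ('a \<Rightarrow> 'k) \<Rightarrow> 'a \<Rightarrow> 'k"
  by (rule vector_space_fun_scale)

lemma sum_fun_apply: "(\<Sum>i\<in>I. f i) x = (\<Sum>i\<in>I. f i x)"
  by (induction I rule: infinite_finite_induct) auto

section \<open>Monomial functions and their linear independence\<close>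

text \<open>If the field were finite, the product \<open>q\<close> of all factors X - a would vanish
  everywhere, and \<open>q + 1\<close> would be a nonconstant polynomial without roots.\<close>

lemma infinite_UNIV_alg_closed: "infinite (UNIV :: 'k::alg_closed_field set)"
proof
  assume fin: "finite (UNIV :: 'k set)"
  define q :: "'k poly" where "q = (\<Prod>a\<in>UNIV. [:- a, 1:])"
  have "degree q = card (UNIV :: 'k set)"
    unfolding q_def by (subst degree_prod_eq_sum_degree) auto
  then have "degree q > 0"
    using fin by (simp add: card_gt_0_iff)
  then have "degree (q + 1) > 0"
    by (simp add: degree_add_eq_left)
  then obtain x where "poly (q + 1) x = 0"
    using alg_closed_imp_poly_has_root by blast
  moreover have "poly q x = 0"
    unfolding q_def poly_prod using fin by (intro prod_zero) auto
  ultimately show False by simp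
qed

text \<open>A nonzero polynomial has only finitely many roots. This recovers exponents from monomial
  functions in \<open>card_le_degree_invariant_monomial\<close>.\<close>

lemma power_fun_inject:
  assumes "infinite (UNIV :: 'k::field set)" and "\<And>t :: 'k. t ^ m = t ^ n"
  shows "m = n"
proof -
  have "{t. poly (monom (1 :: 'k) m - monom 1 n) t = 0} = UNIV"
    using assms(2) by (auto simp: poly_monom)
  then have "monom (1 :: 'k) m - monom 1 n = 0"
    using poly_roots_finite assms(1) by metis
  then show ?thesis
    by (simp add: monom_eq_iff')
qed

text \<open>Dedekind: subtracting a multiple of the relation from its translate eliminates a character.\<close>

lemma independent_characters:
  "fun_vs.independent {\<chi> :: 'a::monoid_mult \<Rightarrow> 'k::field. \<chi> 1 = 1 \<and> (\<forall>x y. \<chi> (x * y) = \<chi> x * \<chi> y)}"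
    (is "fun_vs.independent ?X")
proof -
  have "\<forall>\<chi>\<in>S. c \<chi> = 0"
    if "finite S" "S \<subseteq> ?X" "\<And>x. (\<Sum>\<chi>\<in>S. c \<chi> * \<chi> x) = 0" for S c
    using that
  proof (induction S arbitrary: c rule: finite_induct)
    case (insert \<chi>0 S)
    have \<chi>0: "\<chi>0 1 = 1" "\<And>x y. \<chi>0 (x * y) = \<chi>0 x * \<chi>0 y"
      using insert.prems(1) by auto
    have rel: "c \<chi>0 * \<chi>0 x + (\<Sum>\<chi>\<in>S. c \<chi> * \<chi> x) = 0" for x
      using insert.prems(2)[of x] insert.hyps by simp
    have rel': "(\<Sum>\<chi>\<in>S. c \<chi> * \<chi> x) = - (c \<chi>0 * \<chi>0 x)" for x
      using minus_unique[OF rel[of x]] by simp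
    have "\<forall>\<chi>\<in>S. c \<chi> * (\<chi> y - \<chi>0 y) = 0" for y
    proof (rule insert.IH)
      show "S \<subseteq> ?X" using insert.prems(1) by simp
      fix x
      have *: "\<chi> (y * x) = \<chi> y * \<chi> x" if "\<chi> \<in> S" for \<chi>
        using that insert.prems(1) by auto
      have "(\<Sum>\<chi>\<in>S. c \<chi> * (\<chi> y - \<chi>0 y) * \<chi> x) =
          (\<Sum>\<chi>\<in>S. c \<chi> * \<chi> (y * x)) - \<chi>0 y * (\<Sum>\<chi>\<in>S. c \<chi> * \<chi> x)"
        by (simp add: sum_distrib_left * algebra_simps sum_subtractf[symmetric])
      also have "\<dots> = - (c \<chi>0 * \<chi>0 (y * x)) - \<chi>0 y * (- (c \<chi>0 * \<chi>0 x))"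
        by (simp only: rel')
      also have "\<dots> = 0"
        by (simp add: \<chi>0(2))
      finally show "(\<Sum>\<chi>\<in>S. c \<chi> * (\<chi> y - \<chi>0 y) * \<chi> x) = 0" .
    qed
    moreover have "\<exists>y. \<chi> y \<noteq> \<chi>0 y" if "\<chi> \<in> S" for \<chi>
      using that insert.hyps(2) by (metis ext)
    ultimately have S: "\<forall>\<chi>\<in>S. c \<chi> = 0"
      by (metis mult_eq_0_iff right_minus_eq)
    then have "c \<chi>0 = 0"
      using rel[of 1] \<chi>0(1) by simp
    with S show ?case by simp
  qed simp
  then show ?thesis
    unfolding fun_vs.independent_explicit_module
    by (auto simp: fun_eq_iff sum_fun_apply fun_scale_def)
qed

definition monomial_on :: "'a set \<Rightarrow> ('a \<Rightarrow> nat) \<Rightarrow> ('a \<Rightarrow> 'k::field) \<Rightarrow> 'k" where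
  "monomial_on I a x = (\<Prod>i\<in>I. x i ^ a i)"

text \<open>The elements are functions rather than exponent vectors: vectors inducing the same
  function give a single element, which keeps the set linearly independent over every field.\<close>

definition monomials :: "'a set \<Rightarrow> nat \<Rightarrow> (('a \<Rightarrow> 'k::field) \<Rightarrow> 'k) set" where
  "monomials I d = {monomial_on I a | a. (\<Sum>i\<in>I. a i) = d}"

text \<open>Monomials are multiplicative for the pointwise product of coordinate vectors and take
  the value 1 at its unit, so they are among the characters of
  \<open>independent_characters\<close>.\<close>

lemma independent_monomials: "fun_vs.independent (monomials I d)"
  by (rule fun_vs.independent_mono[OF independent_characters])
    (auto simp: monomials_def monomial_on_def prod.distrib power_mult_distrib)

lemma monomials_mult:
  assumes "m \<in> monomials I d" and "n \<in> monomials I e"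
  shows "m * n \<in> monomials I (d + e)"
proof -
  obtain a b where "m = monomial_on I a" "n = monomial_on I b"
    and "(\<Sum>i\<in>I. a i) = d" "(\<Sum>i\<in>I. b i) = e"
    using assms by (auto simp: monomials_def)
  moreover have "monomial_on I a * monomial_on I b = monomial_on I (\<lambda>i. a i + b i)"
    by (simp add: fun_eq_iff monomial_on_def power_add prod.distrib)
  ultimately show ?thesis
    unfolding monomials_def by (auto simp: sum.distrib intro!: exI[of _ "\<lambda>i. a i + b i"])
qed

lemma span_monomials_mult:
  assumes "F \<in> fun_vs.span (monomials I d)" and "H \<in> fun_vs.span (monomials I e)"
  shows "F * H \<in> fun_vs.span (monomials I (d + e))"
  using assms(1)
proof (induction rule: fun_vs.span_induct_alt)
  case base
  show ?case by (simp only: mult_zero_left mult_zero_right fun_vs.span_zero)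
next
  case (step c m F)
  have "m * H \<in> fun_vs.span (monomials I (d + e))"
    using assms(2)
  proof (induction rule: fun_vs.span_induct_alt)
    case base
    show ?case by (simp only: mult_zero_left mult_zero_right fun_vs.span_zero)
  next
    case (step c' n H)
    have eq: "m * (fun_scale c' n + H) = fun_scale c' (m * n) + m * H"
      by (simp add: fun_eq_iff fun_scale_def algebra_simps)
    show ?case
      unfolding eq
      by (intro fun_vs.span_add fun_vs.span_scale step(2) fun_vs.span_base
          monomials_mult[OF \<open>m \<in> monomials I d\<close> step(1)])
  qed
  then have "fun_scale c (m * H) + F * H \<in> fun_vs.span (monomials I (d + e))"
    by (intro fun_vs.span_add fun_vs.span_scale) (assumption, rule step(2))
  moreover have "(fun_scale c m + F) * H = fun_scale c (m * H) + F * H"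
    by (simp add: fun_eq_iff fun_scale_def algebra_simps)
  ultimately show ?case by (simp only:)
qed

text \<open>Induction along the construction of \<open>f\<close>: a linear form becomes a linear
  combination of coordinates, and \<open>span_monomials_mult\<close> covers products. The vectors
  \<open>v i\<close> need not form a basis, so the translates of a single vector can be inserted
  later.\<close>

lemma homogeneous_poly_fun_in_span_monomials:
  assumes "homogeneous_poly_fun scale d f" and "finite I"
  shows "(\<lambda>x. f (\<Sum>i\<in>I. scale (x i) (v i))) \<in> fun_vs.span (monomials I d)"
  using assms(1)
proof induction
  case (const c)
  have "(\<lambda>x. c) = fun_scale c (monomial_on I (\<lambda>_. 0))"
    by (simp add: fun_eq_iff fun_scale_def monomial_on_def)
  moreover have "monomial_on I (\<lambda>_. 0) \<in> monomials I 0"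
    by (auto simp: monomials_def)
  then have "fun_scale c (monomial_on I (\<lambda>_. 0)) \<in> fun_vs.span (monomials I 0)"
    by (intro fun_vs.span_scale fun_vs.span_base)
  ultimately show ?case by (simp only:)
next
  case (linear l)
  \<comment> \<open>The exponent vector of the single variable \<open>x i\<close>.\<close>
  let ?m = "\<lambda>i. monomial_on I (\<lambda>j. if j = i then 1 else 0)"
  have m: "?m i x = x i" if "i \<in> I" for i x
  proof -
    have "?m i x = (\<Prod>j\<in>I. if j = i then x j else 1)"
      unfolding monomial_on_def by (intro prod.cong) auto
    then show ?thesis using that \<open>finite I\<close> by simp
  qed
  have "(\<lambda>x. l (\<Sum>i\<in>I. scale (x i) (v i))) = (\<Sum>i\<in>I. fun_scale (l (v i)) (?m i))"
    by (auto simp: fun_eq_iff sum_fun_apply fun_scale_def m linear_sumD[OF linear]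
        linear_scaleD[OF linear] intro!: sum.cong)
  moreover have "?m i \<in> monomials I 1" if "i \<in> I" for i
    using that \<open>finite I\<close>
    by (auto simp: monomials_def intro!: exI[of _ "\<lambda>j. if j = i then 1 else 0"])
  then have "(\<Sum>i\<in>I. fun_scale (l (v i)) (?m i)) \<in> fun_vs.span (monomials I 1)"
    by (intro fun_vs.span_sum fun_vs.span_scale fun_vs.span_base)
  ultimately show ?case by (simp only:)
next
  case (add d f g)
  show ?case
    using fun_vs.span_add[OF add.IH] by (simp only: plus_fun_def)
next
  case (mult d f e g)
  show ?case
    using span_monomials_mult[OF mult.IH] by (simp only: times_fun_def)
qed

section \<open>Sums over p-group actions in characteristic p\<close>

text \<open>Split the sum into orbits. The size of an orbit is a power of p, and not 1 since nothing
  is fixed, so the constant weight on it is added a multiple of p times.\<close>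

lemma (in group_action) p_group_sum_eq_0:
  fixes w :: "'c \<Rightarrow> 'k::field"
  assumes "card (carrier G) = p ^ k" and "prime p" and "CHAR('k) = p"
    and "finite S" and "S \<subseteq> E"
    and closed: "\<And>g x. g \<in> carrier G \<Longrightarrow> x \<in> S \<Longrightarrow> \<phi> g x \<in> S"
    and w: "\<And>g x. g \<in> carrier G \<Longrightarrow> x \<in> S \<Longrightarrow> w (\<phi> g x) = w x"
    and no_fixed: "\<And>x. x \<in> S \<Longrightarrow> \<exists>g\<in>carrier G. \<phi> g x \<noteq> x"
  shows "(\<Sum>x\<in>S. w x) = 0"
proof -
  let ?orb = "orbit G \<phi>"
  have orb_S: "?orb x \<subseteq> S" if "x \<in> S" for x
    using that closed by (auto simp: orbit_def)
  \<comment> \<open>Orbits that meet coincide, so the fibres of the orbit map on \<open>S\<close>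
    are the orbits themselves; this allows the regrouping by \<open>sum.image_gen\<close>.\<close>
  have fibre: "{y \<in> S. ?orb y = ?orb x} = ?orb x" if "x \<in> S" for x
  proof -
    have "?orb y = ?orb x" if y: "y \<in> ?orb x" for y
    proof -
      have "x \<in> E" "y \<in> E" using y \<open>x \<in> S\<close> orb_S \<open>S \<subseteq> E\<close> by auto
      then show ?thesis
        using disjoint_union[of "?orb y" "?orb x"] orbit_refl[of y] y by (auto simp: orbits_def)
    qed
    then show ?thesis
      using that orb_S orbit_refl \<open>S \<subseteq> E\<close> by blast
  qed
  have "(\<Sum>y\<in>?orb x. w y) = 0" if x: "x \<in> S" for x
  proof -
    have "card (?orb x) dvd p ^ k"
      using orbit_stabilizer_theorem[of x] x assms(1) \<open>S \<subseteq> E\<close>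
      by (metis Coset.order_def dvd_triv_left subsetD)
    moreover have "card (?orb x) \<noteq> 1"
    proof
      assume "card (?orb x) = 1"
      moreover have "x \<in> ?orb x" using x \<open>S \<subseteq> E\<close> orbit_refl by blast
      ultimately have "?orb x = {x}" by (metis card_1_singletonE singletonD)
      then show False using no_fixed[OF x] by (auto simp: orbit_def)
    qed
    ultimately have "p dvd card (?orb x)"
      using \<open>prime p\<close> by (metis divides_primepow_nat dvd_power neq0_conv power_0)
    then have "of_nat (card (?orb x)) = (0 :: 'k)"
      using \<open>CHAR('k) = p\<close> by (simp add: of_nat_eq_0_iff_char_dvd)
    moreover have "(\<Sum>y\<in>?orb x. w y) = (\<Sum>y\<in>?orb x. w x)"
      using x w by (intro sum.cong) (auto simp: orbit_def)
    ultimately show ?thesis by simp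
  qed
  then have "(\<Sum>Y\<in>?orb ` S. \<Sum>y | y \<in> S \<and> ?orb y = Y. w y) = 0"
    by (intro sum.neutral) (auto simp: fibre)
  then show ?thesis
    using sum.image_gen[OF \<open>finite S\<close>, of w ?orb] by simp
qed

lemma group_action_UNIVI:
  assumes "group G"
    and mult: "\<And>g h x. g \<in> carrier G \<Longrightarrow> h \<in> carrier G \<Longrightarrow> \<phi> (g \<otimes>\<^bsub>G\<^esub> h) x = \<phi> g (\<phi> h x)"
    and one: "\<And>x. \<phi> \<one>\<^bsub>G\<^esub> x = x"
  shows "group_action G UNIV \<phi>"
proof -
  interpret group G by fact
  have bij: "bij (\<phi> g)" if "g \<in> carrier G" for g
    using that mult[of g "inv\<^bsub>G\<^esub> g"] mult[of "inv\<^bsub>G\<^esub> g" g]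
    by (intro o_bij[of "\<phi> (inv\<^bsub>G\<^esub> g)"]) (auto simp: fun_eq_iff one)
  have "\<phi> \<in> hom G (BijGroup UNIV)"
    using mult bij by (auto simp: hom_def BijGroup_def Bij_def compose_def fun_eq_iff)
  then show ?thesis
    by (simp add: group_action_def group_hom_def group_hom_axioms_def is_group group_BijGroup)
qed

section \<open>Degree bound on the regular representation\<close>

text \<open>This is a right action on coordinate vectors, so precomposition with it is a left action
  on functions of them. Values outside the carrier are kept, so that the identity element acts
  trivially on every vector.\<close>

definition translate ::
  "('g, 'x) monoid_scheme \<Rightarrow> 'g \<Rightarrow> ('g \<Rightarrow> 'k) \<Rightarrow> 'g \<Rightarrow> 'k" where
  "translate G g x = (\<lambda>h. if h \<in> carrier G then x (g \<otimes>\<^bsub>G\<^esub> h) else x h)"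

context group
begin

lemma translate_mult:
  "g \<in> carrier G \<Longrightarrow> h \<in> carrier G \<Longrightarrow> translate G (g \<otimes> h) x = translate G h (translate G g x)"
  by (auto simp: translate_def fun_eq_iff m_assoc)

lemma translate_one: "translate G \<one> x = x"
  by (auto simp: translate_def fun_eq_iff)

lemma monomial_translate:
  assumes "g \<in> carrier G"
  shows "monomial_on (carrier G) a (translate G g x) = monomial_on (carrier G) (\<lambda>h. a (inv g \<otimes> h)) x"
  unfolding monomial_on_def
  using assms by (intro prod.reindex_bij_witness[of _ "\<lambda>h. inv g \<otimes> h" "\<lambda>h. g \<otimes> h"])
    (auto simp: translate_def m_assoc[symmetric])

lemma monomials_translate:
  assumes g: "g \<in> carrier G" and m: "m \<in> monomials (carrier G) d"
  shows "(\<lambda>x. m (translate G g x)) \<in> monomials (carrier G) d"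
proof -
  obtain a where a: "m = monomial_on (carrier G) a" "(\<Sum>h\<in>carrier G. a h) = d"
    using m by (auto simp: monomials_def)
  have "(\<Sum>h\<in>carrier G. a (inv g \<otimes> h)) = (\<Sum>h\<in>carrier G. a h)"
    using g by (intro sum.reindex_bij_witness[of _ "\<lambda>h. g \<otimes> h" "\<lambda>h. inv g \<otimes> h"])
      (auto simp: m_assoc[symmetric])
  then show ?thesis
    using a g by (auto simp: monomials_def monomial_translate fun_eq_iff)
qed

text \<open>An exponent vector invariant under \<open>P\<close> that is positive at \<open>h\<close> is positive on all of \<open>P h\<close>.\<close>

lemma card_le_degree_invariant_monomial:
  fixes m :: "('a \<Rightarrow> 'k::field) \<Rightarrow> 'k"
  assumes inf: "infinite (UNIV :: 'k set)" and fin: "finite (carrier G)" and P: "subgroup P G"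
    and m: "m \<in> monomials (carrier G) d" and "d > 0"
    and inv: "\<And>g. g \<in> P \<Longrightarrow> (\<lambda>x. m (translate G g x)) = m"
  shows "card P \<le> d"
proof -
  obtain a where a: "m = monomial_on (carrier G) a" "(\<Sum>h\<in>carrier G. a h) = d"
    using m by (auto simp: monomials_def)
  \<comment> \<open>The vector with entry \<open>t\<close> at \<open>h\<close> and 1 elsewhere
    isolates the exponent at \<open>h\<close>.\<close>
  have eval: "monomial_on (carrier G) b (\<lambda>j. if j = h then t else 1) = t ^ b h"
    if "h \<in> carrier G" for b h and t :: 'k
  proof -
    have "monomial_on (carrier G) b (\<lambda>j. if j = h then t else 1) =
        (\<Prod>j\<in>carrier G. if j = h then t ^ b j else 1)"
      unfolding monomial_on_def by (intro prod.cong) auto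
    then show ?thesis using that fin by simp
  qed
  have a_inv: "a (g \<otimes> h) = a h" if g: "g \<in> P" and h: "h \<in> carrier G" for g h
  proof -
    have gG: "g \<in> carrier G" using g P subgroup.mem_carrier by metis
    have "t ^ a (inv g \<otimes> (g \<otimes> h)) = t ^ a (g \<otimes> h)" for t :: 'k
      using fun_cong[OF inv[OF g], of "\<lambda>j. if j = g \<otimes> h then t else 1"] gG h
      by (simp add: a(1) monomial_translate eval)
    moreover have "inv g \<otimes> (g \<otimes> h) = h"
      using gG h by (simp add: m_assoc[symmetric])
    ultimately show ?thesis
      using power_fun_inject[OF inf] by metis
  qed
  obtain h where h: "h \<in> carrier G" "a h > 0"
    using a(2) \<open>d > 0\<close> by (metis neq0_conv sum.neutral)
  have "P \<subseteq> carrier G" using P by (rule subgroup.subset)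
  then have inj: "inj_on (\<lambda>g. g \<otimes> h) P"
    using h(1) by (rule inj_on_g)
  have "card P = card ((\<lambda>g. g \<otimes> h) ` P)"
    using inj by (simp add: card_image)
  also have "\<dots> = (\<Sum>x\<in>(\<lambda>g. g \<otimes> h) ` P. 1)"
    by simp
  also have "\<dots> \<le> (\<Sum>x\<in>(\<lambda>g. g \<otimes> h) ` P. a x)"
    using h a_inv by (intro sum_mono) auto
  also have "\<dots> \<le> (\<Sum>x\<in>carrier G. a x)"
    using fin h(1) \<open>P \<subseteq> carrier G\<close> by (intro sum_mono2) auto
  finally show ?thesis using a(2) by simp
qed

text \<open>By contradiction: if d < |P|, then by \<open>card_le_degree_invariant_monomial\<close>
  no monomial in the support of \<open>F\<close> is fixed by all of \<open>P\<close>, so the orbit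
  argument makes the whole coefficient sum vanish.\<close>

lemma p_group_card_le_degree:
  fixes F :: "('a \<Rightarrow> 'k::field) \<Rightarrow> 'k"
  assumes inf: "infinite (UNIV :: 'k set)" and fin: "finite (carrier G)" and P: "subgroup P G"
    and card_P: "card P = p ^ k" and "prime p" and "CHAR('k) = p"
    and F: "F \<in> fun_vs.span (monomials (carrier G) d)" and "d > 0"
    and inv: "\<And>g. g \<in> P \<Longrightarrow> (\<lambda>x. F (translate G g x)) = F"
    and "F (\<lambda>_. 1) \<noteq> 0"
  shows "card P \<le> d"
proof (rule ccontr)
  assume not_le: "\<not> card P \<le> d"
  define T where "T g f = (\<lambda>x. f (translate G g x))" for g and f :: "('a \<Rightarrow> 'k) \<Rightarrow> 'k"
  define M :: "(('a \<Rightarrow> 'k) \<Rightarrow> 'k) set" where "M = monomials (carrier G) d"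
  define c where "c = fun_vs.representation M F"
  define S where "S = {m. c m \<noteq> 0}"
  note PG = subgroup.mem_carrier[OF P]
  interpret P: group_action "G\<lparr>carrier := P\<rparr>" UNIV T
    using subgroup.subgroup_is_group[OF P is_group]
    by (rule group_action_UNIVI) (auto simp: T_def translate_mult translate_one PG)
  have indep: "fun_vs.independent M"
    unfolding M_def by (rule independent_monomials)
  have FM: "F \<in> fun_vs.span M"
    using F by (simp add: M_def)
  have finS: "finite S"
    unfolding S_def c_def by (rule fun_vs.finite_representation)
  have S_M: "S \<subseteq> M"
    unfolding S_def c_def using fun_vs.representation_ne_zero by blast
  have F_eq: "F = (\<Sum>m\<in>S. fun_scale (c m) m)"
    unfolding S_def c_def using fun_vs.sum_nonzero_representation_eq[OF indep FM] by simp
  have T_T: "T g (T (inv g) f) = f" "T (inv g) (T g f) = f" if "g \<in> P" for g f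
    using that PG by (simp_all add: T_def translate_mult[symmetric] translate_one)
  have c_T: "c (T g m) = c m" if g: "g \<in> P" for g m
  proof -
    have gi: "inv g \<in> P" using P g by (rule subgroup.m_inv_closed)
    have supp: "{m. c (T g m) \<noteq> 0} = T (inv g) ` S"
      unfolding S_def using T_T[OF g] by (auto intro!: image_eqI[where x = "T g _"])
    \<comment> \<open>The family \<open>\<lambda>m. c (T g m)\<close> consists of the coefficients
      of \<open>T (inv g) F\<close>, which is \<open>F\<close> by invariance. Coordinates with
      respect to the independent set \<open>M\<close> are unique.\<close>
    have "fun_vs.representation M F = (\<lambda>m. c (T g m))"
    proof (rule fun_vs.representation_eqI[OF indep FM])
      show "finite {m. c (T g m) \<noteq> 0}"
        unfolding supp using finS by simp
      show "m \<in> M" if "c (T g m) \<noteq> 0" for m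
      proof -
        have "m \<in> T (inv g) ` S" using that supp by blast
        then show ?thesis
          using S_M monomials_translate[OF PG[OF gi]] by (auto simp: M_def T_def)
      qed
      have "inj_on (T (inv g)) S"
        using T_T(1)[OF g] by (metis inj_onI)
      then have "(\<Sum>m | c (T g m) \<noteq> 0. fun_scale (c (T g m)) m) =
          (\<Sum>m\<in>S. fun_scale (c m) (T (inv g) m))"
        unfolding supp by (simp add: sum.reindex T_T[OF g])
      also have "\<dots> = T (inv g) F"
        unfolding F_eq by (simp add: T_def fun_eq_iff sum_fun_apply fun_scale_def)
      also have "\<dots> = F"
        using inv[OF gi] by (simp add: T_def)
      finally show "(\<Sum>m | c (T g m) \<noteq> 0. fun_scale (c (T g m)) m) = F" .
    qed
    then show ?thesis by (metis c_def)
  qed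
  \<comment> \<open>Since every monomial is 1 at the all-ones vector, evaluation there adds up the
    coefficients.\<close>
  have one: "m (\<lambda>_. 1) = 1" if "m \<in> S" for m
    using that S_M by (auto simp: M_def monomials_def monomial_on_def)
  have "F (\<lambda>_. 1) = (\<Sum>m\<in>S. c m)"
    unfolding F_eq by (simp add: sum_fun_apply fun_scale_def one)
  also have "\<dots> = 0"
  proof (rule P.p_group_sum_eq_0[where p = p and k = k])
    show "T g m \<in> S" if "g \<in> carrier (G\<lparr>carrier := P\<rparr>)" "m \<in> S" for g m
      using that c_T by (simp add: S_def)
    show "\<exists>g\<in>carrier (G\<lparr>carrier := P\<rparr>). T g m \<noteq> m" if m: "m \<in> S" for m
    proof (rule ccontr)
      assume "\<not> ?thesis"
      then have "card P \<le> d"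
        using m S_M \<open>d > 0\<close>
        by (intro card_le_degree_invariant_monomial[OF inf fin P, of m]) (auto simp: M_def T_def)
      with not_le show False by simp
    qed
  qed (use assms finS c_T in auto)
  finally show False using \<open>F (\<lambda>_. 1) \<noteq> 0\<close> by simp
qed

end

section \<open>Lower bound at fixed points of projective modules\<close>

context G_module
begin

lemma p_group_card_le_degree_at_trace:
  assumes inf: "infinite (UNIV :: 'k set)" and fin: "finite (carrier G)" and P: "subgroup P G"
    and "card P = p ^ k" "prime p" "CHAR('k) = p"
    and f: "f \<in> homogeneous_invariants G scale \<rho> d" and "d > 0"
    and nz: "f (\<Sum>h\<in>carrier G. \<rho> h w) \<noteq> 0"
  shows "card P \<le> d"
proof -
  interpret group G by (rule group_G)
  define \<psi> where "\<psi> x = (\<Sum>h\<in>carrier G. scale (x h) (\<rho> h w))" for x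
  \<comment> \<open>Reindexing the sum turns translation by \<open>g\<close> into the action of
    \<open>inv g\<close>, which the invariance of \<open>f\<close> absorbs.\<close>
  have \<psi>: "\<psi> (translate G g x) = \<rho> (inv g) (\<psi> x)" if g: "g \<in> carrier G" for g x
  proof -
    note lin = linear_action[OF inv_closed[OF g]]
    have "(\<Sum>h\<in>carrier G. scale (translate G g x h) (\<rho> h w)) =
        (\<Sum>h\<in>carrier G. \<rho> (inv g) (scale (x h) (\<rho> h w)))"
      using g by (intro sum.reindex_bij_witness[of _ "\<lambda>h. inv g \<otimes> h" "\<lambda>h. g \<otimes> h"])
        (auto simp: translate_def m_assoc[symmetric] linear_scaleD[OF lin] action_mult[symmetric])
    then show ?thesis by (simp add: \<psi>_def linear_sumD[OF lin])
  qed
  have inv: "f (\<rho> (inv g) v) = f v" if "g \<in> carrier G" for g v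
    using f that unfolding homogeneous_invariants_def invariant_ring_def poly_fun_action_def
    by (auto dest: fun_cong)
  show ?thesis
  proof (rule p_group_card_le_degree[OF inf fin P, of p k "\<lambda>x. f (\<psi> x)"])
    show "(\<lambda>x. f (\<psi> x)) \<in> fun_vs.span (monomials (carrier G) d)"
      unfolding \<psi>_def using f fin
      by (intro homogeneous_poly_fun_in_span_monomials) (auto simp: homogeneous_invariants_def)
    show "(\<lambda>x. f (\<psi> (translate G g x))) = (\<lambda>x. f (\<psi> x))" if "g \<in> P" for g
      using subgroup.mem_carrier[OF P that] by (simp add: \<psi> inv)
    show "f (\<psi> (\<lambda>_. 1)) \<noteq> 0"
      using nz by (simp add: \<psi>_def)
  qed (use assms in auto)
qed

text \<open>A fixed element of the free module is determined by its values at the identity and is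
  the trace of that part. The trace respects the decomposition into \<open>A\<close> and
  \<open>B\<close>, so the claim passes to the summand.\<close>

lemma fixed_point_eq_trace:
  assumes fin: "finite (carrier G)" and proj: "projective_module G scale \<rho>"
    and u: "u \<in> fixed_points G \<rho>"
  shows "\<exists>w. u = (\<Sum>h\<in>carrier G. \<rho> h w)"
proof -
  interpret group G by (rule group_G)
  from proj obtain n A B \<phi> where A: "free_submodule G n A" and B: "free_submodule G n B"
    and AB: "A \<inter> B = {0}" "free_carrier G n = {a + b | a b. a \<in> A \<and> b \<in> B}"
    and \<phi>: "G_module_hom G scale \<rho> fun_scale (free_action G) \<phi>" "bij_betw \<phi> UNIV A"
    unfolding projective_module_def by blast
  have lin: "Vector_Spaces.linear scale fun_scale \<phi>"
    and eqv: "\<And>g u. g \<in> carrier G \<Longrightarrow> \<phi> (\<rho> g u) = free_action G g (\<phi> u)"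
    using \<phi> by (auto simp: G_module_hom_def)
  define tr where "tr f = (\<Sum>h\<in>carrier G. free_action G h f)" for f :: "nat \<times> 'g \<Rightarrow> 'k"
  have subA: "fun_vs.subspace A" and subB: "fun_vs.subspace B"
    and actB: "\<And>g b. g \<in> carrier G \<Longrightarrow> b \<in> B \<Longrightarrow> free_action G g b \<in> B"
    using A B by (auto simp: free_submodule_def)
  have \<phi>u: "\<phi> u \<in> A" "\<phi> u \<in> free_carrier G n"
    using \<phi>(2) A by (auto simp: bij_betw_def free_submodule_def)
  have \<phi>u_inv: "free_action G g (\<phi> u) = \<phi> u" if "g \<in> carrier G" for g
    using u that eqv[OF that, of u] by (simp add: fixed_points_def)
  \<comment> \<open>\<open>e\<close> keeps only the values of \<open>\<phi> u\<close> at the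
    identity; its translates add up to \<open>\<phi> u\<close>.\<close>
  define e where "e = (\<lambda>(i, h). if h = \<one> then \<phi> u (i, \<one>) else 0)"
  have "e \<in> free_carrier G n"
    using \<phi>u(2) by (auto simp: e_def free_carrier_def split: if_splits)
  then obtain a b where ab: "a \<in> A" "b \<in> B" "e = a + b"
    using AB(2) by blast
  obtain w where w: "\<phi> w = a"
    using \<phi>(2) ab(1) by (metis bij_betw_imp_surj_on imageE)
  have "\<phi> u = tr e"
  proof
    fix x :: "nat \<times> 'g"
    obtain i h where x: "x = (i, h)" by (cases x)
    show "\<phi> u x = tr e x"
    proof (cases "h \<in> carrier G")
      case True
      have iff: "inv g \<otimes> h = \<one> \<longleftrightarrow> g = h" if "g \<in> carrier G" for g
        using that True by (metis inv_closed inv_equality inv_inv l_inv)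
      have "tr e x = (\<Sum>g\<in>carrier G. if g = h then \<phi> u (i, \<one>) else 0)"
        unfolding tr_def sum_fun_apply x
        using True by (intro sum.cong) (auto simp: free_action_def e_def iff)
      also have "\<dots> = \<phi> u (i, inv h \<otimes> h)"
        using True fin by simp
      also have "\<dots> = \<phi> u x"
        using fun_cong[OF \<phi>u_inv[OF True], of x] True by (simp add: free_action_def x)
      finally show ?thesis by simp
    next
      case False
      then show ?thesis
        using \<phi>u(2) by (auto simp: x free_carrier_def tr_def sum_fun_apply free_action_def)
    qed
  qed
  also have "\<dots> = tr a + tr b"
  proof -
    have "free_action G h (a + b) = free_action G h a + free_action G h b" for h
      by (auto simp: fun_eq_iff free_action_def)
    then show ?thesis by (simp only: ab(3) tr_def sum.distrib)
  qed
  also have tr_a: "tr a = \<phi> (\<Sum>h\<in>carrier G. \<rho> h w)"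
    unfolding tr_def w[symmetric] linear_sumD[OF lin] by (simp add: eqv)
  finally have eq: "\<phi> u = \<phi> (\<Sum>h\<in>carrier G. \<rho> h w) + tr b" .
  \<comment> \<open>\<open>tr b\<close> is a difference of two elements of \<open>A\<close> and a
    sum of translates of \<open>b\<close> in \<open>B\<close>, hence zero.\<close>
  have "\<phi> (\<Sum>h\<in>carrier G. \<rho> h w) \<in> A"
    using \<phi>(2) by (auto simp: bij_betw_def)
  then have "tr b \<in> A"
    using fun_vs.subspace_diff[OF subA \<phi>u(1)] eq by (metis add_diff_cancel_left')
  moreover have "tr b \<in> B"
    unfolding tr_def using actB ab(2) by (intro fun_vs.subspace_sum[OF subB]) auto
  ultimately have "tr b = 0" using AB(1) by blast
  then have "\<phi> u = \<phi> (\<Sum>h\<in>carrier G. \<rho> h w)" using eq by simp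
  then show ?thesis
    using \<phi>(2) by (auto simp: bij_betw_def inj_def)
qed

end

section \<open>Upper bound by the transfer of a norm\<close>

lemma homogeneous_poly_fun_imp_poly_fun: "homogeneous_poly_fun scale d f \<Longrightarrow> poly_fun scale f"
  by (induction rule: homogeneous_poly_fun.induct) (auto intro: poly_fun.intros)

lemma homogeneous_poly_fun_at_zero: "homogeneous_poly_fun scale d f \<Longrightarrow> d > 0 \<Longrightarrow> f 0 = 0"
  by (induction rule: homogeneous_poly_fun.induct) (auto dest: linear_zeroD)

lemma homogeneous_poly_fun_prod:
  assumes "finite I" and "\<And>i. i \<in> I \<Longrightarrow> Vector_Spaces.linear scale (*) (l i)"
  shows "homogeneous_poly_fun scale (card I) (\<lambda>u. \<Prod>i\<in>I. l i u)"
  using assms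
proof (induction I rule: finite_induct)
  case empty
  show ?case using homogeneous_poly_fun.const[of scale 1] by simp
next
  case (insert i I)
  then have "homogeneous_poly_fun scale (1 + card I) (\<lambda>u. l i u * (\<Prod>i\<in>I. l i u))"
    by (intro homogeneous_poly_fun.mult homogeneous_poly_fun.linear) auto
  then show ?case using insert.hyps by simp
qed

text \<open>The induction starts from one summand, since the rules of
  \<open>homogeneous_poly_fun\<close> do not directly provide the zero function in every
  degree.\<close>

lemma homogeneous_poly_fun_sum:
  assumes "finite I" and "I \<noteq> {}" and "\<And>i. i \<in> I \<Longrightarrow> homogeneous_poly_fun scale d (f i)"
  shows "homogeneous_poly_fun scale d (\<lambda>u. \<Sum>i\<in>I. f i u)"
  using assms by (induction I rule: finite_ne_induct) (auto intro: homogeneous_poly_fun.add)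

text \<open>Extend \<open>u\<close> to a basis and take the coordinate at \<open>u\<close>.\<close>

lemma (in vector_space) exists_linear_functional:
  assumes "u \<noteq> 0"
  shows "\<exists>l. Vector_Spaces.linear scale (*) l \<and> l u \<noteq> 0"
proof -
  have indep: "independent {u}" using assms by simp
  define B where "B = extend_basis {u}"
  have B: "independent B" "span B = UNIV" "u \<in> B"
    unfolding B_def
    using independent_extend_basis[OF indep] span_extend_basis[OF indep]
      extend_basis_superset[OF indep] by auto
  then show ?thesis
    using linear_representation[OF B(1,2), of u] representation_basis[OF B(1,3)]
    by (auto intro!: exI[of _ "\<lambda>v. representation B v u"])
qed

lemma (in group) bij_betw_lcosets:
  assumes g: "g \<in> carrier G" and P: "subgroup P G"
  shows "bij_betw (\<lambda>C. g <# C) (lcosets P) (lcosets P)"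
proof (rule bij_betw_byWitness[where f' = "\<lambda>C. inv g <# C"])
  have sub: "C \<subseteq> carrier G" if "C \<in> lcosets P" for C
    using that lcosets_subset_PowG[OF P] by auto
  show "\<forall>C\<in>lcosets P. inv g <# (g <# C) = C" "\<forall>C\<in>lcosets P. g <# (inv g <# C) = C"
    using g sub by (simp_all add: lcos_m_assoc lcos_mult_one)
  have "h <# C \<in> lcosets P" if "h \<in> carrier G" "C \<in> lcosets P" for h C
    using that subgroup.subset[OF P] by (auto simp: LCOSETS_def lcos_m_assoc)
  then show "(\<lambda>C. g <# C) ` (lcosets P) \<subseteq> lcosets P" "(\<lambda>C. inv g <# C) ` (lcosets P) \<subseteq> lcosets P"
    using g by auto
qed

context G_module
begin

text \<open>The relative transfer from \<open>P\<close> to \<open>G\<close> of the norm over \<open>P\<close> of a linear form.\<close>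

definition transfer_norm :: "'g set \<Rightarrow> ('u \<Rightarrow> 'k) \<Rightarrow> 'u \<Rightarrow> 'k" where
  "transfer_norm P l v = (\<Sum>C\<in>lcosets P. \<Prod>h\<in>C. l (\<rho> (inv h) v))"

text \<open>Left multiplication by \<open>g\<close> permutes the left cosets of \<open>P\<close> and
  hence the summands. Taking products over whole cosets avoids a choice of representatives.\<close>

lemma transfer_norm_invariant:
  assumes g: "g \<in> carrier G" and P: "subgroup P G"
  shows "transfer_norm P l (\<rho> (inv g) v) = transfer_norm P l v"
proof -
  interpret group G by (rule group_G)
  have "(\<Prod>h\<in>C. l (\<rho> (inv h) (\<rho> (inv g) v))) = (\<Prod>h\<in>g <# C. l (\<rho> (inv h) v))"
    if "C \<in> lcosets P" for C
  proof -
    have C: "C \<subseteq> carrier G" using that lcosets_subset_PowG[OF P] by auto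
    have "g <# C = (\<lambda>h. g \<otimes> h) ` C" by (auto simp: l_coset_def)
    moreover have "inj_on (\<lambda>h. g \<otimes> h) C" using inj_on_g'[OF C g] .
    moreover have "\<rho> (inv (g \<otimes> h)) v = \<rho> (inv h) (\<rho> (inv g) v)" if "h \<in> C" for h
      using that C g by (auto simp: inv_mult_group action_mult subsetD)
    ultimately show ?thesis by (simp add: prod.reindex)
  qed
  then have "transfer_norm P l (\<rho> (inv g) v) =
      (\<Sum>C\<in>lcosets P. \<Prod>h\<in>g <# C. l (\<rho> (inv h) v))"
    by (simp add: transfer_norm_def)
  also have "\<dots> = transfer_norm P l v"
    unfolding transfer_norm_def by (rule sum.reindex_bij_betw[OF bij_betw_lcosets[OF g P]])
  finally show ?thesis .
qed

lemma transfer_norm_homogeneous_invariant: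
  assumes fin: "finite (carrier G)" and P: "subgroup P G" and l: "Vector_Spaces.linear scale (*) l"
  shows "transfer_norm P l \<in> homogeneous_invariants G scale \<rho> (card P)"
proof -
  interpret group G by (rule group_G)
  have "homogeneous_poly_fun scale (card P) (\<lambda>v. \<Prod>h\<in>C. l (\<rho> (inv h) v))"
    if C: "C \<in> lcosets P" for C
  proof -
    have sub: "C \<subseteq> carrier G" using C lcosets_subset_PowG[OF P] by auto
    have "homogeneous_poly_fun scale (card C) (\<lambda>v. \<Prod>h\<in>C. l (\<rho> (inv h) v))"
    proof (rule homogeneous_poly_fun_prod)
      show "finite C" using sub fin finite_subset by blast
      fix h assume "h \<in> C"
      then have lin: "Vector_Spaces.linear scale scale (\<rho> (inv h))"
        using sub by (intro linear_action) auto
      have "vector_space ((*) :: 'k \<Rightarrow> 'k \<Rightarrow> 'k)"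
        using l by (simp add: Vector_Spaces.linear_def)
      then show "Vector_Spaces.linear scale (*) (\<lambda>v. l (\<rho> (inv h) v))"
        by (rule linearI_vs[OF vector_space_axioms])
          (simp_all add: linear_addD[OF lin] linear_addD[OF l]
            linear_scaleD[OF lin] linear_scaleD[OF l])
    qed
    moreover have "card C = card P"
      using l_card_cosets_equal[OF C subgroup.subset[OF P] fin] by simp
    ultimately show ?thesis by simp
  qed
  moreover have "finite (lcosets P)" "lcosets P \<noteq> {}"
    using fin by (auto simp: LCOSETS_def)
  ultimately have "homogeneous_poly_fun scale (card P) (transfer_norm P l)"
    unfolding transfer_norm_def[abs_def] by (intro homogeneous_poly_fun_sum)
  then show ?thesis
    unfolding homogeneous_invariants_def invariant_ring_def poly_fun_action_def
    using transfer_norm_invariant[OF _ P] homogeneous_poly_fun_imp_poly_fun by auto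
qed

lemma transfer_norm_fixed_point:
  assumes fin: "finite (carrier G)" and P: "subgroup P G" and u: "u \<in> fixed_points G \<rho>"
  shows "transfer_norm P l u = of_nat (card (lcosets P)) * l u ^ card P"
proof -
  interpret group G by (rule group_G)
  have "(\<Prod>h\<in>C. l (\<rho> (inv h) u)) = l u ^ card P" if C: "C \<in> lcosets P" for C
  proof -
    have "C \<subseteq> carrier G" using C lcosets_subset_PowG[OF P] by auto
    then have "(\<Prod>h\<in>C. l (\<rho> (inv h) u)) = (\<Prod>h\<in>C. l u)"
      using u by (intro prod.cong) (auto simp: fixed_points_def)
    then show ?thesis
      using l_card_cosets_equal[OF C subgroup.subset[OF P] fin] by simp
  qed
  then show ?thesis by (simp add: transfer_norm_def)
qed

end

text \<open>Otherwise Lagrange's theorem would make \<open>p * card P\<close> divide the group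
  order, exceeding the multiplicity of \<open>p\<close> in it.\<close>

lemma (in group) sylow_index_not_dvd:
  assumes "prime p" and fin: "finite (carrier G)" and P: "sylow_subgroup p G P"
  shows "\<not> p dvd card (lcosets P)"
proof
  assume "p dvd card (lcosets P)"
  then have "p * card P dvd card (carrier G)"
    using l_lagrange[OF fin] P by (metis Coset.order_def dvd_refl mult_dvd_mono sylow_subgroup_def)
  then have "p ^ Suc (multiplicity p (card (carrier G))) dvd card (carrier G)"
    using P by (simp add: sylow_subgroup_def)
  moreover have "card (carrier G) \<noteq> 0" using fin one_closed by auto
  ultimately show False
    using \<open>prime p\<close> by (metis Suc_n_not_le_n not_prime_unit power_dvd_iff_le_multiplicity)
qed

theorem corollary3p3:
  fixes G :: "('g, 'x) monoid_scheme"
    and P :: "'g set"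
    and p :: nat
    and scale :: "'k::alg_closed_field \<Rightarrow> 'u::ab_group_add \<Rightarrow> 'u"
    and \<rho> :: "'g \<Rightarrow> 'u \<Rightarrow> 'u"
  assumes "CHAR('k) = p" and "p > 0"
    and "group G" and "finite (carrier G)"
    and "sylow_subgroup p G P"
    and "finite_dim_G_module G scale \<rho>"
    and "projective_module G scale \<rho>"
  shows "(\<forall>u \<in> fixed_points G \<rho> - {0}. epsilon_at G scale \<rho> u = enat (card P)) \<and>
    (fixed_points G \<rho> \<noteq> {0} \<longrightarrow> epsilon G scale \<rho> = enat (card P))"
proof -
  interpret finite_dim_G_module G scale \<rho> by fact
  interpret group G by fact
  have "prime p" using prime_CHAR_semidom[where 'a = 'k] assms(1,2) by simp
  have P: "subgroup P G" and card_P: "card P = p ^ multiplicity p (card (carrier G))"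
    using assms(5) by (auto simp: sylow_subgroup_def)
  have pos: "card P > 0" using card_P \<open>p > 0\<close> by simp
  have upper: "\<exists>f\<in>homogeneous_invariants G scale \<rho> (card P). f u \<noteq> 0"
    if u: "u \<in> fixed_points G \<rho>" "u \<noteq> 0" for u
  proof -
    obtain l where l: "Vector_Spaces.linear scale (*) l" "l u \<noteq> 0"
      using exists_linear_functional[OF u(2)] by blast
    have "of_nat (card (lcosets\<^bsub>G\<^esub> P)) \<noteq> (0 :: 'k)"
      using sylow_index_not_dvd[OF \<open>prime p\<close> assms(4,5)] assms(1)
      by (simp add: of_nat_eq_0_iff_char_dvd)
    then have "transfer_norm P l u \<noteq> 0"
      using l(2) by (simp add: transfer_norm_fixed_point[OF assms(4) P u(1)])
    then show ?thesis
      using transfer_norm_homogeneous_invariant[OF assms(4) P l(1)] by blast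
  qed
  have lower: "card P \<le> d"
    if u: "u \<in> fixed_points G \<rho>" and "d > 0" "f \<in> homogeneous_invariants G scale \<rho> d" "f u \<noteq> 0"
    for u d f
  proof -
    obtain w where "u = (\<Sum>h\<in>carrier G. \<rho> h w)"
      using fixed_point_eq_trace[OF assms(4,7) u] by blast
    then show ?thesis
      using p_group_card_le_degree_at_trace[OF infinite_UNIV_alg_closed assms(4) P card_P
          \<open>prime p\<close> assms(1)] that by blast
  qed
  have eps: "epsilon_at G scale \<rho> u = enat (card P)" if u: "u \<in> fixed_points G \<rho>" "u \<noteq> 0" for u
    unfolding epsilon_at_def
  proof (rule antisym)
    show "Inf {enat d |d. d > 0 \<and> (\<exists>f\<in>homogeneous_invariants G scale \<rho> d. f u \<noteq> 0)} \<le> enat (card P)"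
      using upper[OF u] pos by (intro Inf_lower) auto
    show "enat (card P) \<le> Inf {enat d |d. d > 0 \<and> (\<exists>f\<in>homogeneous_invariants G scale \<rho> d. f u \<noteq> 0)}"
      using lower[OF u(1)] by (intro Inf_greatest) auto
  qed
  have "epsilon G scale \<rho> = enat (card P)" if nz: "fixed_points G \<rho> \<noteq> {0}"
  proof -
    have "0 \<in> fixed_points G \<rho>"
      using linear_zeroD[OF linear_action] by (simp add: fixed_points_def)
    then obtain u where u: "u \<in> fixed_points G \<rho>" "u \<noteq> 0"
      using nz by blast
    obtain f where f: "f \<in> homogeneous_invariants G scale \<rho> (card P)" "f u \<noteq> 0"
      using upper[OF u] by blast
    \<comment> \<open>An invariant of positive degree has no constant term, so \<open>f\<close>
      witnesses that \<open>u\<close> lies outside the nullcone.\<close>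
    then have "f 0 = 0"
      using homogeneous_poly_fun_at_zero pos by (auto simp: homogeneous_invariants_def)
    then have "u \<notin> nullcone G scale \<rho>"
      using f by (auto simp: nullcone_def homogeneous_invariants_def)
    \<comment> \<open>Over a nonempty set the infimum of a constant is that constant; over the empty
      set it would be infinite.\<close>
    then have "fixed_points G \<rho> - nullcone G scale \<rho> \<noteq> {}"
      using u by blast
    \<comment> \<open>Hence every point over which the infimum runs is a nonzero fixed point, to
      which \<open>eps\<close> applies.\<close>
    moreover have "0 \<in> nullcone G scale \<rho>"
      by (simp add: nullcone_def)
    then have "epsilon_at G scale \<rho> v = enat (card P)"
      if "v \<in> fixed_points G \<rho> - nullcone G scale \<rho>" for v
      using that eps by (cases "v = 0") auto
    ultimately show ?thesis
      unfolding epsilon_def by simp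
  qed
  then show ?thesis using eps by blast
qed

end
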